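(* Let $\rho>0$, $J=[0,\rho]$, $f:J\times\mathbb R\to\mathbb R\setminus\{0\}$, $g:J\times\mathbb R\to\mathbb R$ and $\Gamma:C(J)\to\mathbb R$. Assume: (i) for each $x\in\mathbb R$ the maps $t\mapsto f(t,x)$ and $t\mapsto g(t,x)$ are continuous on $J$, and $\Gamma$ is Lipschitz with constant $L_\Gamma\geq 0$; (ii) there exist $r>0$, nondecreasing continuous functions $\varphi,\psi:\mathbb R_+\to\mathbb R_+$, and functions $\alpha,\gamma:J\to\mathbb R_+$, bounded, with $\gamma$ Lebesgue measurable, such that for all $t\in J$ and all $x,y\in\mathbb R$ with $|x|,|y|\le r$, $$|f(t,x)-f(t,y)|\le\alpha(t)\,\varphi(|x-y|),\qquad |g(t,x)-g(t,y)|\le\gamma(t)\,\psi(|x-y|);$$ (iii) there is a constant $\delta>0$ such that $\sup_{x\in\mathbb R,\,|x|\le r}|f(0,x)|^{-1}\le\delta$; (iv) with $$M_F=\|\alpha\|_\infty\varphi(r)+\|f(\cdot,0)\|_\infty,\qquad M_G=\delta\,(L_\Gamma r+|\Gamma(0)|)+\rho\|\gamma\|_\infty\psi(r)+\rho\|g(\cdot,0)\|_\infty,$$ one has $M_FM_G\le r$ and $$M_F\delta L_\Gamma t+\Big(M_F\delta^2\alpha(0)\big(L_\Gamma r+|\Gamma(0)|\big)+M_G\|\alpha\|_\infty\Big)\varphi(t)+M_F\|\gamma\|_{L^1}\psi(t)<t\quad\text{for all } t>0;$$ (v) the formulas $F(x)(t)=f(t,x(t))$ and $U_0(x)(s)=g(s,x(s))$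 define maps $F,U_0:C(J)\to C(J)$. Let $\tilde x$ be the unique solution in $\Omega=\{x\in C(J):\|x\|_\infty\le r\}$ of the problem $$\frac{d}{dt}\left(\frac{x(t)}{f(t,x(t))}\right)=g(t,x(t)),\ t\in J,\qquad x(0)=\Gamma(x).$$ Let $\{\tau_n\}_{n\ge1}$ be a Schauder basis of $C(J)$ with associated projections $\{\xi_n\}_{n\ge1}$, and, for an index $n_p\ge1$, let $T_p:C(J)\to C(J)$ be $$T_p(x)(t)=F(x)(t)\left(\frac{\Gamma(x)}{f(0,x(0))}+\int_0^t\xi_{n_p}(U_0(x))(s)\,ds\right).$$ Then for every $x\in\Omega$ and $\varepsilon>0$ there exist $m\in\mathbb N$, $m\ge1$, and indices $n_1,\dots,n_m\ge1$ such that the corresponding operators satisfy $$\|\tilde x-T_m\circ\cdots\circ T_1x\|_\infty\le\varepsilon.$$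
   Context: $C(J)$ is the space of continuous functions $J\to\mathbb R$ with norm $\|x\|_\infty=\sup_{t\in J}|x(t)|$. $\|\alpha\|_\infty$, $\|\gamma\|_\infty$ denote suprema over $J$, and $\|\gamma\|_{L^1}=\int_0^\rho|\gamma(s)|\,ds$. $\Gamma(0)$ is the value of $\Gamma$ at the zero function. A solution is understood as a function $x\in C(J)$; the problem is equivalent to the fixed point equation $x(t)=f(t,x(t))\left[\frac{\Gamma(x)}{f(0,x(0))}+\int_0^t g(s,x(s))\,ds\right]$, and under (i)-(iv) it has exactly one solution in $\Omega$. A Schauder basis of a Banach space $E$ is a sequence $(\tau_n)_{n\ge1}$ such that every $x\in E$ has a unique expansion $x=\sum_{k\ge1}a_k\tau_k$ with real coefficients; its associated projections are $\xi_n\big(\sum_{k\ge1}a_k\tau_k\big)=\sum_{k=1}^na_k\tau_k$, which are continuous and satisfy $\xi_n(x)\to x$ for every $x\in E$. *)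

theory Defs
  imports "HOL-Analysis.Analysis"
begin

text \<open>
  Since \<open>\<rho>\<close> is a variable, \<open>C(J)\<close> with \<open>J = [0,\<rho>]\<close> is a carrier set. Its elements are extensional
  (they take the value \<^term>\<open>undefined\<close> outside \<open>J\<close>), so that equality in the carrier is equality
  on \<open>J\<close> and functionals and operators on the carrier are exactly those on \<open>C(J)\<close>.
\<close>

definition C_space :: "real \<Rightarrow> (real \<Rightarrow> real) set" where
  "C_space \<rho> = {x \<in> extensional {0..\<rho>}. continuous_on {0..\<rho>} x}"

definition sup_norm :: "real \<Rightarrow> (real \<Rightarrow> real) \<Rightarrow> real" where
  "sup_norm \<rho> x = (SUP t\<in>{0..\<rho>}. \<bar>x t\<bar>)"

definition closed_ball_C :: "real \<Rightarrow> real \<Rightarrow> (real \<Rightarrow> real) set" where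
  "closed_ball_C \<rho> r = {x \<in> C_space \<rho>. sup_norm \<rho> x \<le> r}"

definition superposition :: "real \<Rightarrow> (real \<Rightarrow> real \<Rightarrow> real) \<Rightarrow> (real \<Rightarrow> real) \<Rightarrow> (real \<Rightarrow> real)" where
  "superposition \<rho> h x = (\<lambda>t\<in>{0..\<rho>}. h t (x t))"

text \<open>The derivatives at the endpoints of \<open>J\<close> are one-sided.\<close>

definition is_solution ::
  "real \<Rightarrow> (real \<Rightarrow> real \<Rightarrow> real) \<Rightarrow> (real \<Rightarrow> real \<Rightarrow> real) \<Rightarrow> ((real \<Rightarrow> real) \<Rightarrow> real) \<Rightarrow> (real \<Rightarrow> real) \<Rightarrow> bool"
where
  "is_solution \<rho> f g \<Gamma> x \<longleftrightarrow>
     x \<in> C_space \<rho> \<and>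
     (\<forall>t\<in>{0..\<rho>}. ((\<lambda>s. x s / f s (x s)) has_real_derivative g t (x t)) (at t within {0..\<rho>})) \<and>
     x 0 = \<Gamma> x"

text \<open>
  Sequences of basis elements and of coefficients are indexed from 0: \<open>\<tau> k\<close> and \<open>a k\<close> stand for
  \<open>\<tau>\<^sub>k\<^sub>+\<^sub>1\<close> and \<open>a\<^sub>k\<^sub>+\<^sub>1\<close>. The projection \<open>\<xi>\<^sub>n\<close> keeps its index, as it sums the first \<open>n\<close> terms.
\<close>

definition is_expansion :: "real \<Rightarrow> (nat \<Rightarrow> real \<Rightarrow> real) \<Rightarrow> (real \<Rightarrow> real) \<Rightarrow> (nat \<Rightarrow> real) \<Rightarrow> bool" where
  "is_expansion \<rho> \<tau> x a \<longleftrightarrow>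
     (\<lambda>n. sup_norm \<rho> (\<lambda>t. x t - (\<Sum>k<n. a k * \<tau> k t))) \<longlonglongrightarrow> 0"

definition schauder_basis :: "real \<Rightarrow> (nat \<Rightarrow> real \<Rightarrow> real) \<Rightarrow> bool" where
  "schauder_basis \<rho> \<tau> \<longleftrightarrow>
     (\<forall>k. \<tau> k \<in> C_space \<rho>) \<and> (\<forall>x\<in>C_space \<rho>. \<exists>!a. is_expansion \<rho> \<tau> x a)"

definition schauder_coeffs :: "real \<Rightarrow> (nat \<Rightarrow> real \<Rightarrow> real) \<Rightarrow> (real \<Rightarrow> real) \<Rightarrow> nat \<Rightarrow> real" where
  "schauder_coeffs \<rho> \<tau> x = (THE a. is_expansion \<rho> \<tau> x a)"

definition schauder_proj :: "real \<Rightarrow> (nat \<Rightarrow> real \<Rightarrow> real) \<Rightarrow> nat \<Rightarrow> (real \<Rightarrow> real) \<Rightarrow> (real \<Rightarrow> real)" where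
  "schauder_proj \<rho> \<tau> n x = (\<lambda>t\<in>{0..\<rho>}. \<Sum>k<n. schauder_coeffs \<rho> \<tau> x k * \<tau> k t)"

definition approx_op ::
  "real \<Rightarrow> (real \<Rightarrow> real \<Rightarrow> real) \<Rightarrow> (real \<Rightarrow> real \<Rightarrow> real) \<Rightarrow> ((real \<Rightarrow> real) \<Rightarrow> real) \<Rightarrow>
   (nat \<Rightarrow> real \<Rightarrow> real) \<Rightarrow> nat \<Rightarrow> (real \<Rightarrow> real) \<Rightarrow> (real \<Rightarrow> real)"
where
  "approx_op \<rho> f g \<Gamma> \<tau> n x =
     (\<lambda>t\<in>{0..\<rho>}. superposition \<rho> f x t *
        (\<Gamma> x / f 0 (x 0) + integral {0..t} (schauder_proj \<rho> \<tau> n (superposition \<rho> g x))))"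

end

theory Submission
  imports Defs
begin

text \<open>
  Write \<open>T x t = f t (x t) * (\<Gamma> x / f 0 (x 0) + \<integral>\<^sub>0\<^sup>t g s (x s) ds)\<close> for the exact operator. Integrating the
  differential equation shows that the solution is a fixed point of \<open>T\<close>
  (\<open>is_solution_imp_exact_op_fixed\<close>). On the ball \<open>\<Omega>\<close> the growth and modulus conditions give
  \<open>T ` \<Omega> \<subseteq> \<Omega>\<close> and \<open>\<parallel>T x - T y\<parallel> \<le> \<Phi> \<parallel>x - y\<parallel>\<close>, where \<open>\<Phi>\<close> is the left-hand side of the smallness
  condition \<open>\<Phi> t < t\<close> (\<open>exact_op_contraction\<close>). The distances of the exact iterates to the solution
  therefore form a nonincreasing sequence, and their limit \<open>l\<close> satisfies \<open>l \<le> \<Phi> l\<close>, so it is 0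
  (\<open>Boyd_Wong_orbit_tendsto_0\<close>). It remains to approximate one exact iterate by a composition of
  approximate operators.

  The difficulty is that \<open>T\<^sub>1 x\<close> may lie outside \<open>\<Omega>\<close>, where the modulus conditions on \<open>f\<close> and \<open>g\<close> say nothing:
  \<open>T x\<close> can have norm exactly \<open>r\<close>, and the Schauder projections need not preserve norms.
  So the contraction estimate cannot be used to propagate the errors. What replaces it is mere
  continuity of \<open>T\<close> on all of \<open>C(J)\<close>. This holds because a superposition operator that maps \<open>C(J)\<close> to
  itself has a jointly continuous generating function
  (\<open>superposition_preserves_continuity_imp_jointly_continuous\<close>): otherwise some continuous function
  passes through a sequence of points along which the generating function jumps. Joint continuity
  yields uniform continuity on compact sets, hence \<open>T y\<^sub>k \<rightarrow> T z\<close> uniformly whenever \<open>y\<^sub>k \<rightarrow> z\<close> uniformly.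

  Since also \<open>T\<^sub>n y \<rightarrow> T y\<close> for each fixed \<open>y\<close> as the projection index grows, the indices can be
  chosen one after the other, the last one depending on the function reached so far
  (\<open>approx_op_compositions_tend_to_exact_iterate\<close>).
\<close>

section \<open>The supremum norm and uniform convergence\<close>

lemma abs_le_sup_norm:
  assumes "bounded (x ` {0..\<rho>})" "t \<in> {0..\<rho>}"
  shows "\<bar>x t\<bar> \<le> sup_norm \<rho> x"
proof -
  have "bdd_above ((\<lambda>t. \<bar>x t\<bar>) ` {0..\<rho>})"
    using assms(1) by (fastforce simp: bounded_iff bdd_above_def)
  then show ?thesis
    unfolding sup_norm_def using assms(2) by (rule cSUP_upper2) auto
qed

lemma bounded_continuous_image_Icc:
  fixes x :: "real \<Rightarrow> real"
  assumes "continuous_on {a..b} x"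
  shows "bounded (x ` {a..b})"
  using assms by (intro compact_imp_bounded compact_continuous_image) auto

lemma continuous_abs_le_sup_norm:
  assumes "continuous_on {0..\<rho>} x" "t \<in> {0..\<rho>}"
  shows "\<bar>x t\<bar> \<le> sup_norm \<rho> x"
  using abs_le_sup_norm bounded_continuous_image_Icc assms by blast

lemma sup_norm_le:
  assumes "\<rho> \<ge> 0" "\<And>t. t \<in> {0..\<rho>} \<Longrightarrow> \<bar>x t\<bar> \<le> c"
  shows "sup_norm \<rho> x \<le> c"
  unfolding sup_norm_def using assms by (intro cSUP_least) auto

lemma sup_norm_nonneg:
  assumes "\<rho> \<ge> 0" "bounded (x ` {0..\<rho>})"
  shows "0 \<le> sup_norm \<rho> x"
  using abs_le_sup_norm[OF assms(2), of 0] assms(1) by auto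

lemma uniform_limit_iff_sup_norm_tendsto_0:
  assumes "\<rho> \<ge> 0" and y: "\<And>k. continuous_on {0..\<rho>} (y k)" and z: "continuous_on {0..\<rho>} z"
  shows "uniform_limit {0..\<rho>} y z sequentially
           \<longleftrightarrow> (\<lambda>k. sup_norm \<rho> (\<lambda>t. y k t - z t)) \<longlonglongrightarrow> 0" (is "?U \<longleftrightarrow> ?S")
proof
  have cont: "continuous_on {0..\<rho>} (\<lambda>t. y k t - z t)" for k
    using y z by (intro continuous_intros)
  have nonneg: "0 \<le> sup_norm \<rho> (\<lambda>t. y k t - z t)" for k
    using assms(1) bounded_continuous_image_Icc[OF cont] by (rule sup_norm_nonneg)
  show ?S if ?U
  proof (rule tendstoI)
    fix e :: real assume "e > 0"
    then have "\<forall>\<^sub>F k in sequentially. \<forall>t\<in>{0..\<rho>}. dist (y k t) (z t) < e / 2"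
      by (intro uniform_limitD[OF that]) auto
    then show "\<forall>\<^sub>F k in sequentially. dist (sup_norm \<rho> (\<lambda>t. y k t - z t)) 0 < e"
    proof eventually_elim
      case (elim k)
      then have "sup_norm \<rho> (\<lambda>t. y k t - z t) \<le> e / 2"
        using assms(1) by (intro sup_norm_le) (auto simp: dist_real_def less_imp_le)
      then show ?case using nonneg[of k] \<open>e > 0\<close> by simp
    qed
  qed
  show ?U if ?S
  proof (rule uniform_limitI)
    fix e :: real assume "e > 0"
    from tendstoD[OF that this]
    show "\<forall>\<^sub>F k in sequentially. \<forall>t\<in>{0..\<rho>}. dist (y k t) (z t) < e"
    proof eventually_elim
      case (elim k)
      have "dist (y k t) (z t) < e" if "t \<in> {0..\<rho>}" for t
        using continuous_abs_le_sup_norm[OF cont that, of k] elim by (simp add: dist_real_def)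
      then show ?case by blast
    qed
  qed
qed

lemma uniform_limit_indefinite_integral:
  fixes h :: "nat \<Rightarrow> real \<Rightarrow> real"
  assumes "\<rho> \<ge> 0" and h: "\<And>k. continuous_on {0..\<rho>} (h k)" "continuous_on {0..\<rho>} h'"
    and lim: "uniform_limit {0..\<rho>} h h' sequentially"
  shows "uniform_limit {0..\<rho>} (\<lambda>k t. integral {0..t} (h k)) (\<lambda>t. integral {0..t} h') sequentially"
proof (rule uniform_limitI)
  fix e :: real assume "e > 0"
  then have "e / (\<rho> + 1) > 0" using assms(1) by simp
  from uniform_limitD[OF lim this]
  show "\<forall>\<^sub>F k in sequentially. \<forall>t\<in>{0..\<rho>}. dist (integral {0..t} (h k)) (integral {0..t} h') < e"
  proof eventually_elim
    case (elim k)
    show ?case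
    proof
      fix t assume t: "t \<in> {0..\<rho>}"
      then have cont: "continuous_on {0..t} (h k)" "continuous_on {0..t} h'"
        by (auto intro: continuous_on_subset[OF h(1)] continuous_on_subset[OF h(2)])
      have "\<bar>integral {0..t} (\<lambda>s. h k s - h' s)\<bar> \<le> e / (\<rho> + 1) * (t - 0)"
        unfolding real_norm_def[symmetric] using t elim cont
        by (intro integral_bound continuous_intros) (auto simp: dist_real_def less_imp_le)
      also have "\<dots> \<le> e / (\<rho> + 1) * \<rho>"
        using t \<open>e > 0\<close> by (intro mult_left_mono) auto
      also have "\<dots> < e" using \<open>e > 0\<close> assms(1) by (simp add: field_simps)
      finally show "dist (integral {0..t} (h k)) (integral {0..t} h') < e"
        using cont by (simp add: dist_real_def integral_diff integrable_continuous_real)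
    qed
  qed
qed

lemma C_space_iff:
  "x \<in> C_space \<rho> \<longleftrightarrow> x \<in> extensional {0..\<rho>} \<and> continuous_on {0..\<rho>} x"
  by (simp add: C_space_def)

lemma restrict_in_C_space:
  assumes "continuous_on {0..\<rho>} x"
  shows "(\<lambda>t\<in>{0..\<rho>}. x t) \<in> C_space \<rho>"
  using assms by (auto simp: C_space_iff intro: continuous_on_eq)

section \<open>Schauder projections converge uniformly\<close>

lemma schauder_proj_in_C_space:
  assumes "schauder_basis \<rho> \<tau>"
  shows "schauder_proj \<rho> \<tau> n x \<in> C_space \<rho>"
proof -
  have "continuous_on {0..\<rho>} (\<tau> k)" for k
    using assms by (simp add: schauder_basis_def C_space_iff)
  then show ?thesis
    unfolding schauder_proj_def
    by (intro restrict_in_C_space continuous_on_sum continuous_on_mult continuous_on_const)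
qed

lemma schauder_proj_uniform_limit:
  assumes "\<rho> \<ge> 0" "schauder_basis \<rho> \<tau>" "x \<in> C_space \<rho>"
  shows "uniform_limit {0..\<rho>} (\<lambda>n. schauder_proj \<rho> \<tau> n x) x sequentially"
proof -
  have "\<exists>!a. is_expansion \<rho> \<tau> x a"
    using assms(2,3) by (simp add: schauder_basis_def)
  then have "is_expansion \<rho> \<tau> x (schauder_coeffs \<rho> \<tau> x)"
    unfolding schauder_coeffs_def by (rule theI')
  moreover have "sup_norm \<rho> (\<lambda>t. x t - (\<Sum>k<n. schauder_coeffs \<rho> \<tau> x k * \<tau> k t))
      = sup_norm \<rho> (\<lambda>t. schauder_proj \<rho> \<tau> n x t - x t)" for n
    unfolding sup_norm_def by (intro SUP_cong) (auto simp: schauder_proj_def abs_minus_commute)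
  ultimately have "(\<lambda>n. sup_norm \<rho> (\<lambda>t. schauder_proj \<rho> \<tau> n x t - x t)) \<longlonglongrightarrow> 0"
    by (simp add: is_expansion_def)
  then show ?thesis
    using assms schauder_proj_in_C_space[OF assms(2)]
    by (subst uniform_limit_iff_sup_norm_tendsto_0) (auto simp: C_space_iff)
qed

section \<open>Superposition operators on spaces of continuous functions\<close>

lemma exists_near_in_Icc:
  fixes t :: real
  assumes "a < b" "t \<in> {a..b}" "d > 0"
  shows "\<exists>s\<in>{a..b}. s \<noteq> t \<and> \<bar>s - t\<bar> < d"
proof (cases "t < b")
  case True
  with assms show ?thesis
    by (intro bexI[of _ "t + min (d / 2) (b - t)"]) (auto simp: min_def)
next
  case False
  with assms show ?thesis
    by (intro bexI[of _ "t - min (d / 2) (b - a)"]) (auto simp: min_def)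
qed

text \<open>
  The points \<open>(s n, v n)\<close> together with their limit form a compact set on which the first projection
  is injective. Its inverse is therefore continuous on a compact set of nodes, so the interpolating
  function is continuous there and Tietze's theorem extends it.
\<close>

lemma continuous_interpolation_of_convergent_sequence:
  fixes s v :: "nat \<Rightarrow> real"
  assumes "inj s" "\<And>n. s n \<noteq> t" "s \<longlonglongrightarrow> t" "v \<longlonglongrightarrow> u"
  shows "\<exists>x. continuous_on UNIV x \<and> (\<forall>n. x (s n) = v n) \<and> x t = u"
proof -
  define K where "K = insert (t, u) (range (\<lambda>n. (s n, v n)))"
  have "compact K"
    unfolding K_def using assms(3,4) by (intro compact_sequence_with_limit tendsto_Pair)
  have inj: "inj_on fst K"
    using assms(1,2) by (fastforce simp: K_def inj_on_def inj_def)
  have "compact (fst ` K)"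
    using \<open>compact K\<close> by (intro compact_continuous_image continuous_intros)
  have "continuous_on (fst ` K) (inv_into K fst)"
    using \<open>compact K\<close> inj by (intro continuous_on_inv continuous_intros) auto
  then have "continuous_on (fst ` K) (\<lambda>a. snd (inv_into K fst a))"
    by (intro continuous_intros)
  then obtain x where x: "continuous_on UNIV x"
      "\<And>a. a \<in> fst ` K \<Longrightarrow> x a = snd (inv_into K fst a)"
    using \<open>compact (fst ` K)\<close>
    by (metis Tietze_unbounded closed_closedin compact_imp_closed subtopology_UNIV)
  have "x (fst p) = snd p" if "p \<in> K" for p
    using x(2)[of "fst p"] inv_into_f_f[OF inj that] that by auto
  then have "x (s n) = v n" "x t = u" for n
    by (force simp: K_def)+
  with x(1) show ?thesis by blast
qed

text \<open>
  If \<open>f\<close> jumps by \<open>e\<close> at \<open>(t, u)\<close>, there are points \<open>(s n, v n)\<close> converging to \<open>(t, u)\<close> at which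
  \<open>f\<close> stays away from \<open>f t u\<close>; a continuous \<open>x\<close> with \<open>x (s n) = v n\<close> and \<open>x t = u\<close> then has a
  discontinuous image. Interpolation requires the \<open>s n\<close> to be distinct from each other and from
  \<open>t\<close>, and the continuity of the sections \<open>f \<cdot> v\<close> allows moving a point off the line over \<open>t\<close>.
\<close>

lemma superposition_preserves_continuity_imp_jointly_continuous:
  fixes f :: "real \<Rightarrow> real \<Rightarrow> real"
  assumes "\<rho> > 0" and sect: "\<And>u. continuous_on {0..\<rho>} (\<lambda>t. f t u)"
    and super: "\<And>x. x \<in> C_space \<rho> \<Longrightarrow> superposition \<rho> f x \<in> C_space \<rho>"
  shows "continuous_on ({0..\<rho>} \<times> UNIV) (\<lambda>(t, u). f t u)"
proof (rule ccontr)
  assume "\<not> ?thesis"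
  then have "\<exists>t u e. t \<in> {0..\<rho>} \<and> e > 0
      \<and> (\<forall>d>0. \<exists>s v. s \<in> {0..\<rho>} \<and> dist (s, v) (t, u) < d \<and> \<not> \<bar>f s v - f t u\<bar> < e)"
    unfolding continuous_on_iff by (simp add: dist_real_def Bex_def)
  then obtain t u e where t: "t \<in> {0..\<rho>}" and "e > 0"
    and far: "\<And>d. d > 0 \<Longrightarrow> \<exists>s v. s \<in> {0..\<rho>} \<and> dist (s, v) (t, u) < d \<and> e \<le> \<bar>f s v - f t u\<bar>"
    unfolding not_less by auto
  have far': "\<exists>s v. s \<in> {0..\<rho>} \<and> s \<noteq> t \<and> \<bar>s - t\<bar> < d \<and> \<bar>v - u\<bar> < d \<and> e / 2 \<le> \<bar>f s v - f t u\<bar>"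
    if "d > 0" for d
  proof -
    obtain s v where s: "s \<in> {0..\<rho>}" and near: "dist (s, v) (t, u) < d"
      and e: "e \<le> \<bar>f s v - f t u\<bar>"
      using far[OF \<open>d > 0\<close>] by blast
    have sv: "\<bar>s - t\<bar> < d" "\<bar>v - u\<bar> < d"
      using dist_fst_le[of "(s, v)" "(t, u)"] dist_snd_le[of "(s, v)" "(t, u)"] near
      by (auto simp: dist_real_def)
    show ?thesis
    proof (cases "s = t")
      case False
      with s sv e \<open>e > 0\<close> show ?thesis by (intro exI[of _ s] exI[of _ v]) auto
    next
      case True
      \<comment> \<open>Moving off the line over \<open>t\<close> costs at most half of the jump.\<close>
      from sect[of v] t \<open>e > 0\<close> obtain d' where "d' > 0"
        and d': "\<And>s'. s' \<in> {0..\<rho>} \<Longrightarrow> \<bar>s' - t\<bar> < d' \<Longrightarrow> \<bar>f s' v - f t v\<bar> < e / 2"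
        unfolding continuous_on_iff dist_real_def by (meson half_gt_zero)
      obtain s' where "s' \<in> {0..\<rho>}" "s' \<noteq> t" "\<bar>s' - t\<bar> < min d d'"
        using exists_near_in_Icc[OF \<open>\<rho> > 0\<close> t, of "min d d'"] \<open>d > 0\<close> \<open>d' > 0\<close> by auto
      with d'[of s'] e True sv show ?thesis
        by (intro exI[of _ s'] exI[of _ v]) (auto simp: abs_if split: if_splits)
    qed
  qed
  \<comment> \<open>Strictly decreasing distances to \<open>t\<close> keep the nodes distinct.\<close>
  have "\<exists>p. \<forall>n. (fst (p n) \<in> {0..\<rho>} \<and> fst (p n) \<noteq> t
        \<and> \<bar>fst (p n) - t\<bar> < 1 / Suc n \<and> \<bar>snd (p n) - u\<bar> < 1 / Suc n
        \<and> e / 2 \<le> \<bar>f (fst (p n)) (snd (p n)) - f t u\<bar>)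
      \<and> \<bar>fst (p (Suc n)) - t\<bar> < \<bar>fst (p n) - t\<bar>"
  proof (rule dependent_nat_choice, goal_cases)
    case 1
    then show ?case using far'[of 1] by auto
  next
    case (2 p n)
    then have "min (1 / Suc (Suc n)) \<bar>fst p - t\<bar> > 0" by auto
    from far'[OF this] show ?case by auto
  qed
  then obtain p where p: "\<And>n. fst (p n) \<in> {0..\<rho>}" "\<And>n. fst (p n) \<noteq> t"
      "\<And>n. \<bar>fst (p n) - t\<bar> < 1 / Suc n" "\<And>n. \<bar>snd (p n) - u\<bar> < 1 / Suc n"
      "\<And>n. e / 2 \<le> \<bar>f (fst (p n)) (snd (p n)) - f t u\<bar>"
      "\<And>n. \<bar>fst (p (Suc n)) - t\<bar> < \<bar>fst (p n) - t\<bar>"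
    by blast
  define s v where "s n = fst (p n)" and "v n = snd (p n)" for n
  have "strict_mono (\<lambda>n. - \<bar>s n - t\<bar>)"
    using p(6) by (simp add: strict_mono_Suc_iff s_def)
  then have "inj s"
    using strict_mono_eq by (fastforce intro!: injI)
  have "s \<longlonglongrightarrow> t"
    by (rule Lim_null[THEN iffD2], rule Lim_null_comparison[OF _ LIMSEQ_Suc[OF lim_1_over_n]])
      (use p(3) in \<open>auto simp: s_def less_imp_le\<close>)
  have "v \<longlonglongrightarrow> u"
    by (rule Lim_null[THEN iffD2], rule Lim_null_comparison[OF _ LIMSEQ_Suc[OF lim_1_over_n]])
      (use p(4) in \<open>auto simp: v_def less_imp_le\<close>)
  obtain x where x: "continuous_on UNIV x" "\<And>n. x (s n) = v n" "x t = u"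
    using continuous_interpolation_of_convergent_sequence[OF \<open>inj s\<close> _ \<open>s \<longlonglongrightarrow> t\<close> \<open>v \<longlonglongrightarrow> u\<close>] p(2)
    by (auto simp: s_def)
  define x' where "x' = (\<lambda>t\<in>{0..\<rho>}. x t)"
  have "x' \<in> C_space \<rho>"
    unfolding x'_def using x(1) by (intro restrict_in_C_space) (rule continuous_on_subset, auto)
  then have "continuous_on {0..\<rho>} (superposition \<rho> f x')"
    using super by (simp add: C_space_iff)
  then have "(\<lambda>n. superposition \<rho> f x' (s n)) \<longlonglongrightarrow> superposition \<rho> f x' t"
    by (rule continuous_on_tendsto_compose[OF _ \<open>s \<longlonglongrightarrow> t\<close> t])
      (intro always_eventually allI p(1)[folded s_def])
  then have "(\<lambda>n. f (s n) (v n)) \<longlonglongrightarrow> f t u"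
    using p(1)[folded s_def] t x(2,3) by (simp add: superposition_def x'_def)
  from tendstoD[OF this, of "e / 2"] \<open>e > 0\<close> obtain n where "\<bar>f (s n) (v n) - f t u\<bar> < e / 2"
    by (auto simp: dist_real_def eventually_sequentially)
  with p(5)[of n] show False by (simp add: s_def v_def)
qed

text \<open>
  The graphs of the \<open>y k\<close> eventually stay in one compact set around the graph of \<open>z\<close>, on which \<open>h\<close>
  is uniformly continuous.
\<close>

lemma uniform_limit_superposition:
  fixes h :: "real \<Rightarrow> real \<Rightarrow> real"
  assumes h: "continuous_on ({0..\<rho>} \<times> UNIV) (\<lambda>(t, u). h t u)"
    and lim: "uniform_limit {0..\<rho>} y z sequentially" and z: "continuous_on {0..\<rho>} z"
  shows "uniform_limit {0..\<rho>} (\<lambda>k. superposition \<rho> h (y k)) (superposition \<rho> h z) sequentially"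
proof -
  define R where "R = sup_norm \<rho> z"
  have R: "\<bar>z t\<bar> \<le> R" if "t \<in> {0..\<rho>}" for t
    unfolding R_def using z that by (rule continuous_abs_le_sup_norm)
  define B where "B = {0..\<rho>} \<times> {- (R + 1)..R + 1}"
  have "compact B" unfolding B_def by (intro compact_Times) auto
  moreover have "continuous_on B (\<lambda>(t, u). h t u)"
    by (rule continuous_on_subset[OF h]) (auto simp: B_def)
  ultimately have unif: "uniformly_continuous_on B (\<lambda>(t, u). h t u)"
    by (intro compact_uniformly_continuous)
  have "uniform_limit {0..\<rho>} (\<lambda>k t. (t, y k t)) (\<lambda>t. (t, z t)) sequentially"
    using lim by (simp add: uniform_limit_iff dist_Pair_Pair)
  moreover have "\<forall>\<^sub>F k in sequentially. \<forall>t\<in>{0..\<rho>}. (t, y k t) \<in> B"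
    using uniform_limitD[OF lim zero_less_one]
  proof eventually_elim
    case (elim k)
    show ?case
    proof
      fix t assume "t \<in> {0..\<rho>}"
      with elim R[of t] show "(t, y k t) \<in> B" by (force simp: B_def dist_real_def)
    qed
  qed
  ultimately have "uniform_limit {0..\<rho>} (\<lambda>k t. h t (y k t)) (\<lambda>t. h t (z t)) sequentially"
    using uniform_limit_compose_uniformly_continuous_on[OF _ unif] compact_imp_closed[OF \<open>compact B\<close>]
    by fastforce
  then show ?thesis
    by (rule uniform_limit_cong'[THEN iffD1, rotated 2]) (auto simp: superposition_def)
qed

section \<open>Orbits of nonlinear contractions\<close>

text \<open>
  The orbit is nonincreasing, and its limit \<open>l\<close> satisfies \<open>l \<le> \<Phi> l\<close> by continuity, which leaves only
  \<open>l = 0\<close>. Continuity also gives \<open>\<Phi> 0 \<le> 0\<close>, so the orbit stays at 0 once it gets there.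
\<close>

lemma Boyd_Wong_orbit_tendsto_0:
  fixes d :: "nat \<Rightarrow> real"
  assumes "\<And>k. d k \<ge> 0" "\<And>k. d (Suc k) \<le> \<Phi> (d k)"
    and cont: "continuous_on {0..} \<Phi>" and less: "\<And>t. t > 0 \<Longrightarrow> \<Phi> t < t"
  shows "d \<longlonglongrightarrow> 0"
proof -
  have Phi_tendsto: "(\<lambda>k. \<Phi> (c k)) \<longlonglongrightarrow> \<Phi> l"
    if "c \<longlonglongrightarrow> l" "\<And>k. c k \<ge> 0" for c :: "nat \<Rightarrow> real" and l
    using that LIMSEQ_le_const[OF that(1), of 0] by (intro continuous_on_tendsto_compose[OF cont]) auto
  have "\<Phi> 0 \<le> 0"
  proof (rule LIMSEQ_le)
    show "(\<lambda>k. 1 / real (Suc k)) \<longlonglongrightarrow> 0" by (rule LIMSEQ_Suc[OF lim_1_over_n])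
    then show "(\<lambda>k. \<Phi> (1 / real (Suc k))) \<longlonglongrightarrow> \<Phi> 0" by (rule Phi_tendsto) auto
    show "\<exists>N. \<forall>n\<ge>N. \<Phi> (1 / real (Suc n)) \<le> 1 / real (Suc n)"
      by (intro exI allI impI less_imp_le less) simp
  qed
  then have le: "\<Phi> t \<le> t" if "t \<ge> 0" for t
    using less[of t] that by (cases "t = 0") auto
  have "decseq d"
    using assms(1,2) le by (intro decseq_SucI) (meson order_trans)
  then obtain l where l: "d \<longlonglongrightarrow> l"
    using assms(1) decseq_convergent by metis
  have "l \<ge> 0" using LIMSEQ_le_const[OF l, of 0] assms(1) by auto
  have "l \<le> \<Phi> l"
    using LIMSEQ_Suc[OF l] Phi_tendsto[OF l assms(1)] by (rule LIMSEQ_le) (use assms(2) in auto)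
  with less[of l] \<open>l \<ge> 0\<close> have "l = 0" by force
  with l show ?thesis by simp
qed

section \<open>The equation in integrated form\<close>

text \<open>
  The exact and the approximate operators differ only in the integrand, so it is a separate argument
  here. Varying \<open>x\<close> and \<open>h\<close> together lets one limit theorem cover both the continuity of the exact
  operator and the convergence of the approximate ones.
\<close>

definition product_op ::
  "real \<Rightarrow> (real \<Rightarrow> real \<Rightarrow> real) \<Rightarrow> ((real \<Rightarrow> real) \<Rightarrow> real) \<Rightarrow>
   (real \<Rightarrow> real) \<Rightarrow> (real \<Rightarrow> real) \<Rightarrow> (real \<Rightarrow> real)"
where
  "product_op \<rho> f \<Gamma> x h =
     (\<lambda>t\<in>{0..\<rho>}. superposition \<rho> f x t * (\<Gamma> x / f 0 (x 0) + integral {0..t} h))"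

definition exact_op ::
  "real \<Rightarrow> (real \<Rightarrow> real \<Rightarrow> real) \<Rightarrow> (real \<Rightarrow> real \<Rightarrow> real) \<Rightarrow> ((real \<Rightarrow> real) \<Rightarrow> real) \<Rightarrow>
   (real \<Rightarrow> real) \<Rightarrow> (real \<Rightarrow> real)"
where
  "exact_op \<rho> f g \<Gamma> x = product_op \<rho> f \<Gamma> x (superposition \<rho> g x)"

lemma approx_op_eq_product_op:
  "approx_op \<rho> f g \<Gamma> \<tau> n x = product_op \<rho> f \<Gamma> x (schauder_proj \<rho> \<tau> n (superposition \<rho> g x))"
  by (simp add: approx_op_def product_op_def)

section \<open>Continuity of the operators on the whole space\<close>

text \<open>
  The hypotheses that hold on all of \<open>C(J)\<close>, kept apart from those that are tied to the ball: the
  composed approximations are only controlled by the former.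
\<close>

locale hybrid_operators =
  fixes \<rho> L :: real and f g :: "real \<Rightarrow> real \<Rightarrow> real" and \<Gamma> :: "(real \<Rightarrow> real) \<Rightarrow> real"
  assumes rho_pos: "\<rho> > 0"
    and f_nonzero: "\<And>t x. t \<in> {0..\<rho>} \<Longrightarrow> f t x \<noteq> 0"
    and f_continuous: "\<And>x. continuous_on {0..\<rho>} (\<lambda>t. f t x)"
    and g_continuous: "\<And>x. continuous_on {0..\<rho>} (\<lambda>t. g t x)"
    and Gamma_Lipschitz: "\<And>x y. x \<in> C_space \<rho> \<Longrightarrow> y \<in> C_space \<rho> \<Longrightarrow>
           \<bar>\<Gamma> x - \<Gamma> y\<bar> \<le> L * sup_norm \<rho> (\<lambda>t. x t - y t)"
    and super_f: "\<And>x. x \<in> C_space \<rho> \<Longrightarrow> superposition \<rho> f x \<in> C_space \<rho>"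
    and super_g: "\<And>x. x \<in> C_space \<rho> \<Longrightarrow> superposition \<rho> g x \<in> C_space \<rho>"
begin

lemma continuous_on_super:
  assumes "x \<in> C_space \<rho>"
  shows "continuous_on {0..\<rho>} (superposition \<rho> f x)" "continuous_on {0..\<rho>} (superposition \<rho> g x)"
  using super_f[OF assms] super_g[OF assms] by (simp_all add: C_space_iff)

lemma product_op_in_C_space:
  assumes "x \<in> C_space \<rho>" "continuous_on {0..\<rho>} h"
  shows "product_op \<rho> f \<Gamma> x h \<in> C_space \<rho>"
  unfolding product_op_def
  using indefinite_integral_continuous_1[OF integrable_continuous_real[OF assms(2)]]
  by (intro restrict_in_C_space continuous_on_mult continuous_on_add continuous_on_const
      continuous_on_super(1)[OF assms(1)])

lemma exact_op_in_C_space: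
  assumes "x \<in> C_space \<rho>"
  shows "exact_op \<rho> f g \<Gamma> x \<in> C_space \<rho>"
  unfolding exact_op_def using assms continuous_on_super(2) by (intro product_op_in_C_space)

lemma approx_op_in_C_space:
  assumes "schauder_basis \<rho> \<tau>" "x \<in> C_space \<rho>"
  shows "approx_op \<rho> f g \<Gamma> \<tau> n x \<in> C_space \<rho>"
  unfolding approx_op_eq_product_op
  using assms(2) schauder_proj_in_C_space[OF assms(1)]
  by (intro product_op_in_C_space) (auto simp: C_space_iff)

lemma product_op_uniform_limit:
  assumes y: "\<And>k. y k \<in> C_space \<rho>" and z: "z \<in> C_space \<rho>"
    and yz: "uniform_limit {0..\<rho>} y z sequentially"
    and h: "\<And>k. continuous_on {0..\<rho>} (h k)" "continuous_on {0..\<rho>} h'"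
    and hh': "uniform_limit {0..\<rho>} h h' sequentially"
  shows "uniform_limit {0..\<rho>} (\<lambda>k. product_op \<rho> f \<Gamma> (y k) (h k)) (product_op \<rho> f \<Gamma> z h') sequentially"
proof -
  have cont: "continuous_on {0..\<rho>} (y k)" "continuous_on {0..\<rho>} z" for k
    using y z by (auto simp: C_space_iff)
  have F: "uniform_limit {0..\<rho>} (\<lambda>k. superposition \<rho> f (y k)) (superposition \<rho> f z) sequentially"
    using superposition_preserves_continuity_imp_jointly_continuous[OF rho_pos f_continuous super_f]
      yz cont(2) by (rule uniform_limit_superposition)
  have sup: "(\<lambda>k. sup_norm \<rho> (\<lambda>t. y k t - z t)) \<longlonglongrightarrow> 0"
    using uniform_limit_iff_sup_norm_tendsto_0[OF _ cont] yz rho_pos by auto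
  have "(\<lambda>k. \<Gamma> (y k) - \<Gamma> z) \<longlonglongrightarrow> 0"
  proof (rule Lim_null_comparison)
    show "\<forall>\<^sub>F k in sequentially. norm (\<Gamma> (y k) - \<Gamma> z) \<le> L * sup_norm \<rho> (\<lambda>t. y k t - z t)"
      using Gamma_Lipschitz[OF y z] by (intro always_eventually) auto
    show "(\<lambda>k. L * sup_norm \<rho> (\<lambda>t. y k t - z t)) \<longlonglongrightarrow> 0"
      using tendsto_mult_left[OF sup, of L] by simp
  qed
  then have Gamma: "(\<lambda>k. \<Gamma> (y k)) \<longlonglongrightarrow> \<Gamma> z"
    by (simp add: Lim_null[symmetric])
  have "(\<lambda>k. superposition \<rho> f (y k) 0) \<longlonglongrightarrow> superposition \<rho> f z 0"
    using F rho_pos by (intro tendsto_uniform_limitI[OF F]) auto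
  then have f0: "(\<lambda>k. f 0 (y k 0)) \<longlonglongrightarrow> f 0 (z 0)"
    using rho_pos by (simp add: superposition_def)
  have "(\<lambda>k. \<Gamma> (y k) / f 0 (y k 0)) \<longlonglongrightarrow> \<Gamma> z / f 0 (z 0)"
    using Gamma f0 f_nonzero[of 0] rho_pos by (intro tendsto_divide) auto
  then have "uniform_limit {0..\<rho>} (\<lambda>k t. \<Gamma> (y k) / f 0 (y k 0)) (\<lambda>t. \<Gamma> z / f 0 (z 0)) sequentially"
    by (simp add: uniform_limit_iff tendsto_iff eventually_mono)
  moreover have "uniform_limit {0..\<rho>} (\<lambda>k t. integral {0..t} (h k)) (\<lambda>t. integral {0..t} h') sequentially"
    using rho_pos h hh' by (intro uniform_limit_indefinite_integral) auto
  ultimately have A: "uniform_limit {0..\<rho>} (\<lambda>k t. \<Gamma> (y k) / f 0 (y k 0) + integral {0..t} (h k))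
      (\<lambda>t. \<Gamma> z / f 0 (z 0) + integral {0..t} h') sequentially"
    by (rule uniform_limit_add)
  have "bounded (superposition \<rho> f z ` {0..\<rho>})"
    using continuous_on_super(1)[OF z] by (rule bounded_continuous_image_Icc)
  moreover have "bounded ((\<lambda>t. \<Gamma> z / f 0 (z 0) + integral {0..t} h') ` {0..\<rho>})"
    using indefinite_integral_continuous_1[OF integrable_continuous_real[OF h(2)]]
    by (intro bounded_continuous_image_Icc continuous_on_add continuous_on_const)
  ultimately have "uniform_limit {0..\<rho>}
      (\<lambda>k t. superposition \<rho> f (y k) t * (\<Gamma> (y k) / f 0 (y k 0) + integral {0..t} (h k)))
      (\<lambda>t. superposition \<rho> f z t * (\<Gamma> z / f 0 (z 0) + integral {0..t} h')) sequentially"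
    by (intro uniform_lim_mult F A)
  then show ?thesis
    by (rule uniform_limit_cong'[THEN iffD1, rotated 2]) (auto simp: product_op_def)
qed

lemma exact_op_uniform_limit:
  assumes "\<And>k. y k \<in> C_space \<rho>" "z \<in> C_space \<rho>" "uniform_limit {0..\<rho>} y z sequentially"
  shows "uniform_limit {0..\<rho>} (\<lambda>k. exact_op \<rho> f g \<Gamma> (y k)) (exact_op \<rho> f g \<Gamma> z) sequentially"
  unfolding exact_op_def
proof (rule product_op_uniform_limit[OF assms])
  show "uniform_limit {0..\<rho>} (\<lambda>k. superposition \<rho> g (y k)) (superposition \<rho> g z) sequentially"
    using superposition_preserves_continuity_imp_jointly_continuous[OF rho_pos g_continuous super_g]
      assms(2,3) by (intro uniform_limit_superposition) (auto simp: C_space_iff)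
qed (use assms continuous_on_super in auto)

lemma approx_op_uniform_limit:
  assumes "schauder_basis \<rho> \<tau>" "x \<in> C_space \<rho>"
  shows "uniform_limit {0..\<rho>} (\<lambda>n. approx_op \<rho> f g \<Gamma> \<tau> n x) (exact_op \<rho> f g \<Gamma> x) sequentially"
  unfolding exact_op_def approx_op_eq_product_op
proof (rule product_op_uniform_limit[OF assms(2,2)])
  show "uniform_limit {0..\<rho>} (\<lambda>n. schauder_proj \<rho> \<tau> n (superposition \<rho> g x)) (superposition \<rho> g x) sequentially"
    using rho_pos assms super_g by (intro schauder_proj_uniform_limit) auto
qed (use schauder_proj_in_C_space[OF assms(1)] continuous_on_super(2)[OF assms(2)]
      in \<open>auto simp: C_space_iff uniform_limit_const\<close>)

text \<open>
  By the fundamental theorem of calculus the integral in \<open>T x t\<close> is the increment of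
  \<open>x s / f s (x s)\<close> from 0 to \<open>t\<close>, and \<open>x 0 = \<Gamma> x\<close> makes its initial value cancel.
\<close>

lemma is_solution_imp_exact_op_fixed:
  assumes "is_solution \<rho> f g \<Gamma> x"
  shows "exact_op \<rho> f g \<Gamma> x = x"
proof
  fix t
  have x: "x \<in> C_space \<rho>" "x 0 = \<Gamma> x"
    and deriv: "\<And>t. t \<in> {0..\<rho>} \<Longrightarrow>
      ((\<lambda>s. x s / f s (x s)) has_real_derivative g t (x t)) (at t within {0..\<rho>})"
    using assms by (auto simp: is_solution_def)
  show "exact_op \<rho> f g \<Gamma> x t = x t"
  proof (cases "t \<in> {0..\<rho>}")
    case True
    have "((\<lambda>s. g s (x s)) has_integral x t / f t (x t) - x 0 / f 0 (x 0)) {0..t}"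
    proof (rule fundamental_theorem_of_calculus)
      fix s assume "s \<in> {0..t}"
      with True have "s \<in> {0..\<rho>}" "{0..t} \<subseteq> {0..\<rho>}" by auto
      with deriv[of s] show "((\<lambda>s. x s / f s (x s)) has_vector_derivative g s (x s)) (at s within {0..t})"
        by (auto simp: has_real_derivative_iff_has_vector_derivative intro: has_vector_derivative_within_subset)
    qed (use True in auto)
    moreover have "integral {0..t} (superposition \<rho> g x) = integral {0..t} (\<lambda>s. g s (x s))"
      using True by (intro integral_cong) (auto simp: superposition_def)
    ultimately have "integral {0..t} (superposition \<rho> g x) = x t / f t (x t) - x 0 / f 0 (x 0)"
      by (simp add: integral_unique)
    then show ?thesis
      using True x(2) f_nonzero[OF True] by (simp add: exact_op_def product_op_def superposition_def)
  next
    case False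
    then show ?thesis
      using x(1) by (auto simp: exact_op_def product_op_def C_space_iff extensional_def)
  qed
qed

section \<open>Compositions of approximate operators\<close>

lemma exact_op_funpow_in_C_space:
  assumes "x \<in> C_space \<rho>"
  shows "(exact_op \<rho> f g \<Gamma> ^^ p) x \<in> C_space \<rho>"
  using assms by (induction p) (auto intro: exact_op_in_C_space)

text \<open>
  Along the sequence index \<open>k\<close>, the approximate orbits \<open>y k\<close> of length \<open>p\<close> tend to the exact
  iterate, hence so do their images \<open>T (y k)\<close> to the next one. For each \<open>k\<close> the new projection index
  is taken so large that the error at \<open>y k\<close> is below \<open>1 / (k + 1)\<close>. Stating the claim with a
  sequence of index choices makes plain sequential continuity of \<open>T\<close> sufficient for the induction.
\<close>

lemma approx_op_compositions_tend_to_exact_iterate: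
  assumes basis: "schauder_basis \<rho> \<tau>" and x: "x \<in> C_space \<rho>"
  shows "\<exists>n :: nat \<Rightarrow> nat \<Rightarrow> nat. (\<forall>k q. n k q \<ge> 1) \<and>
           (\<forall>k. fold (\<lambda>q. approx_op \<rho> f g \<Gamma> \<tau> (n k q)) [1..<Suc p] x \<in> C_space \<rho>) \<and>
           uniform_limit {0..\<rho>} (\<lambda>k. fold (\<lambda>q. approx_op \<rho> f g \<Gamma> \<tau> (n k q)) [1..<Suc p] x)
             ((exact_op \<rho> f g \<Gamma> ^^ p) x) sequentially"
proof (induction p)
  case 0
  show ?case
    by (rule exI[of _ "\<lambda>k q. 1"]) (use x in \<open>simp add: uniform_limit_const\<close>)
next
  case (Suc p)
  then obtain n where n: "\<And>k q. n k q \<ge> (1::nat)"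
    and C: "\<And>k. fold (\<lambda>q. approx_op \<rho> f g \<Gamma> \<tau> (n k q)) [1..<Suc p] x \<in> C_space \<rho>"
    and lim: "uniform_limit {0..\<rho>} (\<lambda>k. fold (\<lambda>q. approx_op \<rho> f g \<Gamma> \<tau> (n k q)) [1..<Suc p] x)
             ((exact_op \<rho> f g \<Gamma> ^^ p) x) sequentially"
    by blast
  define y where "y k = fold (\<lambda>q. approx_op \<rho> f g \<Gamma> \<tau> (n k q)) [1..<Suc p] x" for k
  have yC: "y k \<in> C_space \<rho>" for k using C by (simp add: y_def)
  have lim': "uniform_limit {0..\<rho>} (\<lambda>k. exact_op \<rho> f g \<Gamma> (y k)) ((exact_op \<rho> f g \<Gamma> ^^ Suc p) x) sequentially"
    using exact_op_uniform_limit[OF yC exact_op_funpow_in_C_space[OF x] lim[folded y_def]] by simp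
  have "\<exists>N\<ge>1. \<forall>t\<in>{0..\<rho>}. dist (approx_op \<rho> f g \<Gamma> \<tau> N (y k) t) (exact_op \<rho> f g \<Gamma> (y k) t) < 1 / Suc k" for k
  proof -
    have "\<forall>\<^sub>F N in sequentially. \<forall>t\<in>{0..\<rho>}.
        dist (approx_op \<rho> f g \<Gamma> \<tau> N (y k) t) (exact_op \<rho> f g \<Gamma> (y k) t) < 1 / Suc k"
      by (rule uniform_limitD[OF approx_op_uniform_limit[OF basis yC]]) simp
    with eventually_ge_at_top[of 1] have "\<forall>\<^sub>F N in sequentially. N \<ge> 1 \<and> (\<forall>t\<in>{0..\<rho>}.
        dist (approx_op \<rho> f g \<Gamma> \<tau> N (y k) t) (exact_op \<rho> f g \<Gamma> (y k) t) < 1 / Suc k)"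
      by (rule eventually_conj)
    then show ?thesis by (auto simp: eventually_sequentially)
  qed
  then obtain N where N: "\<And>k. N k \<ge> 1"
    and close: "\<And>k t. t \<in> {0..\<rho>} \<Longrightarrow>
        dist (approx_op \<rho> f g \<Gamma> \<tau> (N k) (y k) t) (exact_op \<rho> f g \<Gamma> (y k) t) < 1 / Suc k"
    by metis
  define n' where "n' k = (n k)(Suc p := N k)" for k
  have "fold (\<lambda>q. approx_op \<rho> f g \<Gamma> \<tau> (n' k q)) [1..<Suc p] x = y k" for k
    unfolding y_def by (rule fold_cong) (auto simp: n'_def)
  then have step: "fold (\<lambda>q. approx_op \<rho> f g \<Gamma> \<tau> (n' k q)) [1..<Suc (Suc p)] x
      = approx_op \<rho> f g \<Gamma> \<tau> (N k) (y k)" for k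
    by (simp add: n'_def)
  have "uniform_limit {0..\<rho>} (\<lambda>k t. approx_op \<rho> f g \<Gamma> \<tau> (N k) (y k) t - exact_op \<rho> f g \<Gamma> (y k) t)
      (\<lambda>t. 0) sequentially"
  proof (rule uniform_limitI)
    fix e :: real assume "e > 0"
    from order_tendstoD(2)[OF LIMSEQ_Suc[OF lim_1_over_n] this]
    show "\<forall>\<^sub>F k in sequentially. \<forall>t\<in>{0..\<rho>}.
        dist (approx_op \<rho> f g \<Gamma> \<tau> (N k) (y k) t - exact_op \<rho> f g \<Gamma> (y k) t) 0 < e"
    proof eventually_elim
      case (elim k)
      show ?case
      proof
        fix t assume "t \<in> {0..\<rho>}"
        from close[OF this, of k] elim
        show "dist (approx_op \<rho> f g \<Gamma> \<tau> (N k) (y k) t - exact_op \<rho> f g \<Gamma> (y k) t) 0 < e"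
          by (simp add: dist_real_def)
      qed
    qed
  qed
  from uniform_limit_add[OF this lim']
  have "uniform_limit {0..\<rho>} (\<lambda>k. approx_op \<rho> f g \<Gamma> \<tau> (N k) (y k)) ((exact_op \<rho> f g \<Gamma> ^^ Suc p) x) sequentially"
    by simp
  moreover have "n' k q \<ge> 1" for k q
    using n N by (simp add: n'_def)
  ultimately show ?case
    using approx_op_in_C_space[OF basis yC] by (intro exI[of _ n']) (simp only: step, simp)
qed

end

section \<open>The nonlinear contraction estimate on the ball\<close>

lemma bounded_measurable_integrable_Icc:
  fixes h :: "real \<Rightarrow> real"
  assumes "bounded (h ` {a..b})" "h \<in> borel_measurable (lebesgue_on {a..b})"
  shows "integrable (lebesgue_on {a..b}) h"
proof -
  obtain B where B: "\<And>t. t \<in> {a..b} \<Longrightarrow> norm (h t) \<le> B"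
    using assms(1) unfolding bounded_iff by blast
  interpret finite_measure "lebesgue_on {a..b}"
    by (rule finite_measure_lebesgue_on) simp
  show ?thesis
    by (rule integrable_const_bound[OF AE_I2 assms(2)]) (use B in simp)
qed

text \<open>
  The supremum in the bound on \<open>1 / f 0\<close> is unfolded into its pointwise form, the only one that the
  estimates refer to.
\<close>

locale hybrid_problem = hybrid_operators \<rho> L f g \<Gamma>
  for \<rho> L :: real and f g :: "real \<Rightarrow> real \<Rightarrow> real" and \<Gamma> :: "(real \<Rightarrow> real) \<Rightarrow> real" +
  fixes r \<delta> M\<^sub>F M\<^sub>G :: real and \<phi> \<psi> \<alpha> \<gamma> :: "real \<Rightarrow> real"
  assumes L_nonneg: "L \<ge> 0"
    and r_pos: "r > 0"
    and phi: "mono_on {0..} \<phi>" "continuous_on {0..} \<phi>" "\<And>t. t \<ge> 0 \<Longrightarrow> \<phi> t \<ge> 0"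
    and psi: "mono_on {0..} \<psi>" "continuous_on {0..} \<psi>" "\<And>t. t \<ge> 0 \<Longrightarrow> \<psi> t \<ge> 0"
    and alpha: "bounded (\<alpha> ` {0..\<rho>})" "\<And>t. t \<in> {0..\<rho>} \<Longrightarrow> \<alpha> t \<ge> 0"
    and gamma: "bounded (\<gamma> ` {0..\<rho>})" "\<And>t. t \<in> {0..\<rho>} \<Longrightarrow> \<gamma> t \<ge> 0"
           "\<gamma> \<in> borel_measurable (lebesgue_on {0..\<rho>})"
    and f_modulus: "\<And>t x y. t \<in> {0..\<rho>} \<Longrightarrow> \<bar>x\<bar> \<le> r \<Longrightarrow> \<bar>y\<bar> \<le> r \<Longrightarrow>
           \<bar>f t x - f t y\<bar> \<le> \<alpha> t * \<phi> \<bar>x - y\<bar>"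
    and g_modulus: "\<And>t x y. t \<in> {0..\<rho>} \<Longrightarrow> \<bar>x\<bar> \<le> r \<Longrightarrow> \<bar>y\<bar> \<le> r \<Longrightarrow>
           \<bar>g t x - g t y\<bar> \<le> \<gamma> t * \<psi> \<bar>x - y\<bar>"
    and delta: "\<And>u. \<bar>u\<bar> \<le> r \<Longrightarrow> inverse \<bar>f 0 u\<bar> \<le> \<delta>"
    and MF: "M\<^sub>F = sup_norm \<rho> \<alpha> * \<phi> r + sup_norm \<rho> (\<lambda>t. f t 0)"
    and MG: "M\<^sub>G = \<delta> * (L * r + \<bar>\<Gamma> (\<lambda>t\<in>{0..\<rho>}. 0)\<bar>)
                   + \<rho> * sup_norm \<rho> \<gamma> * \<psi> r + \<rho> * sup_norm \<rho> (\<lambda>t. g t 0)"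
    and MF_MG: "M\<^sub>F * M\<^sub>G \<le> r"
begin

definition \<Phi> :: "real \<Rightarrow> real" where
  "\<Phi> t = M\<^sub>F * \<delta> * L * t
         + (M\<^sub>F * \<delta>\<^sup>2 * \<alpha> 0 * (L * r + \<bar>\<Gamma> (\<lambda>t\<in>{0..\<rho>}. 0)\<bar>) + M\<^sub>G * sup_norm \<rho> \<alpha>) * \<phi> t
         + M\<^sub>F * (LINT s|lebesgue_on {0..\<rho>}. \<bar>\<gamma> s\<bar>) * \<psi> t"

lemma continuous_on_Phi: "continuous_on {0..} \<Phi>"
  unfolding \<Phi>_def
  by (intro continuous_on_add continuous_on_mult continuous_on_const continuous_on_id phi(2) psi(2))

lemma abs_le_r:
  assumes "x \<in> closed_ball_C \<rho> r" "t \<in> {0..\<rho>}"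
  shows "\<bar>x t\<bar> \<le> r"
  using assms continuous_abs_le_sup_norm[of \<rho> x t] by (simp add: closed_ball_C_def C_space_iff)

lemma f_growth:
  assumes "t \<in> {0..\<rho>}" "\<bar>u\<bar> \<le> r"
  shows "\<bar>f t u\<bar> \<le> M\<^sub>F"
proof -
  have "\<bar>f t u - f t 0\<bar> \<le> \<alpha> t * \<phi> \<bar>u\<bar>"
    using f_modulus[OF assms, of 0] r_pos by simp
  also have "\<dots> \<le> sup_norm \<rho> \<alpha> * \<phi> r"
  proof (rule mult_mono')
    show "\<alpha> t \<le> sup_norm \<rho> \<alpha>" using abs_le_sup_norm[OF alpha(1) assms(1)] by simp
    show "\<phi> \<bar>u\<bar> \<le> \<phi> r" using assms(2) r_pos by (intro mono_onD[OF phi(1)]) auto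
  qed (use alpha(2) assms(1) phi(3) in auto)
  finally show ?thesis
    using continuous_abs_le_sup_norm[OF f_continuous assms(1), of 0] unfolding MF by linarith
qed

lemma g_growth:
  assumes "t \<in> {0..\<rho>}" "\<bar>u\<bar> \<le> r"
  shows "\<bar>g t u\<bar> \<le> sup_norm \<rho> \<gamma> * \<psi> r + sup_norm \<rho> (\<lambda>t. g t 0)"
proof -
  have "\<bar>g t u - g t 0\<bar> \<le> \<gamma> t * \<psi> \<bar>u\<bar>"
    using g_modulus[OF assms, of 0] r_pos by simp
  also have "\<dots> \<le> sup_norm \<rho> \<gamma> * \<psi> r"
  proof (rule mult_mono')
    show "\<gamma> t \<le> sup_norm \<rho> \<gamma>" using abs_le_sup_norm[OF gamma(1) assms(1)] by simp
    show "\<psi> \<bar>u\<bar> \<le> \<psi> r" using assms(2) r_pos by (intro mono_onD[OF psi(1)]) auto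
  qed (use gamma(2) assms(1) psi(3) in auto)
  finally show ?thesis
    using continuous_abs_le_sup_norm[OF g_continuous assms(1), of 0] by linarith
qed

lemma Gamma_growth:
  assumes "x \<in> closed_ball_C \<rho> r"
  shows "\<bar>\<Gamma> x\<bar> \<le> L * r + \<bar>\<Gamma> (\<lambda>t\<in>{0..\<rho>}. 0)\<bar>"
proof -
  have "x \<in> C_space \<rho>" "(\<lambda>t\<in>{0..\<rho>}. 0) \<in> C_space \<rho>"
    using assms by (auto simp: closed_ball_C_def intro: restrict_in_C_space)
  from Gamma_Lipschitz[OF this]
  have "\<bar>\<Gamma> x - \<Gamma> (\<lambda>t\<in>{0..\<rho>}. 0)\<bar> \<le> L * sup_norm \<rho> (\<lambda>t. x t - (\<lambda>t\<in>{0..\<rho>}. 0) t)" .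
  also have "\<dots> \<le> L * r"
    using rho_pos abs_le_r[OF assms] L_nonneg by (intro mult_left_mono sup_norm_le) auto
  finally show ?thesis by linarith
qed

definition inner_op :: "(real \<Rightarrow> real) \<Rightarrow> real \<Rightarrow> real" where
  "inner_op x t = \<Gamma> x / f 0 (x 0) + integral {0..t} (superposition \<rho> g x)"

lemma exact_op_eq_inner_op:
  "t \<in> {0..\<rho>} \<Longrightarrow> exact_op \<rho> f g \<Gamma> x t = f t (x t) * inner_op x t"
  by (simp add: exact_op_def product_op_def inner_op_def superposition_def)

lemma inner_op_growth:
  assumes x: "x \<in> closed_ball_C \<rho> r" and t: "t \<in> {0..\<rho>}"
  shows "\<bar>inner_op x t\<bar> \<le> M\<^sub>G"
proof -
  let ?G = "sup_norm \<rho> \<gamma> * \<psi> r + sup_norm \<rho> (\<lambda>t. g t 0)"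
  have "0 \<in> {0..\<rho>}" using rho_pos by auto
  have "\<bar>\<Gamma> x / f 0 (x 0)\<bar> = inverse \<bar>f 0 (x 0)\<bar> * \<bar>\<Gamma> x\<bar>"
    by (simp add: divide_inverse abs_mult mult.commute)
  also have "\<dots> \<le> \<delta> * (L * r + \<bar>\<Gamma> (\<lambda>t\<in>{0..\<rho>}. 0)\<bar>)"
    using delta[OF abs_le_r[OF x \<open>0 \<in> _\<close>]] Gamma_growth[OF x] by (intro mult_mono') auto
  finally have 1: "\<bar>\<Gamma> x / f 0 (x 0)\<bar> \<le> \<delta> * (L * r + \<bar>\<Gamma> (\<lambda>t\<in>{0..\<rho>}. 0)\<bar>)" .
  have "continuous_on {0..\<rho>} (superposition \<rho> g x)"
    using x continuous_on_super(2) by (simp add: closed_ball_C_def)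
  then have "continuous_on {0..t} (superposition \<rho> g x)"
    by (rule continuous_on_subset) (use t in auto)
  then have "\<bar>integral {0..t} (superposition \<rho> g x)\<bar> \<le> ?G * (t - 0)"
    unfolding real_norm_def[symmetric]
  proof (rule integral_bound[rotated])
    fix s assume "s \<in> {0..t}"
    with t have "s \<in> {0..\<rho>}" by auto
    with g_growth[OF this abs_le_r[OF x this]] show "norm (superposition \<rho> g x s) \<le> ?G"
      by (simp add: superposition_def)
  qed (use t in auto)
  also have "\<dots> \<le> ?G * \<rho>"
    using t g_growth[OF \<open>0 \<in> _\<close>, of 0] r_pos by (intro mult_left_mono) auto
  also have "\<dots> = \<rho> * sup_norm \<rho> \<gamma> * \<psi> r + \<rho> * sup_norm \<rho> (\<lambda>t. g t 0)"
    by (simp add: algebra_simps)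
  finally show ?thesis
    using 1 unfolding inner_op_def MG by linarith
qed

lemma exact_op_in_closed_ball:
  assumes "x \<in> closed_ball_C \<rho> r"
  shows "exact_op \<rho> f g \<Gamma> x \<in> closed_ball_C \<rho> r"
proof -
  have "\<bar>exact_op \<rho> f g \<Gamma> x t\<bar> \<le> r" if "t \<in> {0..\<rho>}" for t
  proof -
    have "\<bar>exact_op \<rho> f g \<Gamma> x t\<bar> \<le> M\<^sub>F * M\<^sub>G"
      unfolding exact_op_eq_inner_op[OF that] abs_mult
      using f_growth[OF that abs_le_r[OF assms that]] inner_op_growth[OF assms that]
      by (intro mult_mono') auto
    with MF_MG show ?thesis by simp
  qed
  with assms show ?thesis
    using rho_pos exact_op_in_C_space by (auto simp: closed_ball_C_def intro: sup_norm_le)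
qed

lemma inner_op_modulus:
  assumes x: "x \<in> closed_ball_C \<rho> r" and y: "y \<in> closed_ball_C \<rho> r" and t: "t \<in> {0..\<rho>}"
  defines "d \<equiv> sup_norm \<rho> (\<lambda>t. x t - y t)"
  shows "\<bar>inner_op x t - inner_op y t\<bar>
    \<le> \<delta> * L * d + \<delta>\<^sup>2 * \<alpha> 0 * (L * r + \<bar>\<Gamma> (\<lambda>t\<in>{0..\<rho>}. 0)\<bar>) * \<phi> d
       + (LINT s|lebesgue_on {0..\<rho>}. \<bar>\<gamma> s\<bar>) * \<psi> d"
proof -
  have 0: "0 \<in> {0..\<rho>}" using rho_pos by auto
  have xC: "x \<in> C_space \<rho>" and yC: "y \<in> C_space \<rho>"
    using x y by (auto simp: closed_ball_C_def)
  have "continuous_on {0..\<rho>} (\<lambda>t. x t - y t)"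
    using xC yC by (auto simp: C_space_iff intro: continuous_on_diff)
  then have dist: "\<bar>x s - y s\<bar> \<le> d" if "s \<in> {0..\<rho>}" for s
    unfolding d_def using that by (rule continuous_abs_le_sup_norm)
  then have d: "d \<ge> 0" using dist[OF 0] by linarith
  let ?a = "f 0 (x 0)" and ?b = "f 0 (y 0)"
  have inv: "inverse \<bar>?a\<bar> \<le> \<delta>" "inverse \<bar>?b\<bar> \<le> \<delta>"
    using delta abs_le_r x y 0 by auto
  have nz: "?a \<noteq> 0" "?b \<noteq> 0" using f_nonzero 0 by auto
  have ab: "\<bar>?b - ?a\<bar> \<le> \<alpha> 0 * \<phi> d"
  proof -
    have "\<bar>?b - ?a\<bar> \<le> \<alpha> 0 * \<phi> \<bar>x 0 - y 0\<bar>"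
      using f_modulus[OF 0 abs_le_r[OF x 0] abs_le_r[OF y 0]] by (simp add: abs_minus_commute)
    also have "\<dots> \<le> \<alpha> 0 * \<phi> d"
      using dist[OF 0] d alpha(2)[OF 0] by (intro mult_left_mono mono_onD[OF phi(1)]) auto
    finally show ?thesis .
  qed
  \<comment> \<open>The term with \<open>\<Gamma> x - \<Gamma> y\<close> gives the linear part of \<open>\<Phi>\<close>, the other one, with two factors
    \<open>1 / f\<close>, the part with \<open>\<delta>\<^sup>2\<close>.\<close>
  have "\<Gamma> x / ?a - \<Gamma> y / ?b = (\<Gamma> x - \<Gamma> y) * inverse ?a + \<Gamma> y * (inverse ?a * inverse ?b * (?b - ?a))"
    using nz by (simp add: field_simps)
  then have "\<bar>\<Gamma> x / ?a - \<Gamma> y / ?b\<bar>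
      \<le> \<bar>\<Gamma> x - \<Gamma> y\<bar> * inverse \<bar>?a\<bar> + \<bar>\<Gamma> y\<bar> * (inverse \<bar>?a\<bar> * inverse \<bar>?b\<bar> * \<bar>?b - ?a\<bar>)"
    by (metis abs_inverse abs_mult abs_triangle_ineq)
  also have "\<dots> \<le> L * d * \<delta> + (L * r + \<bar>\<Gamma> (\<lambda>t\<in>{0..\<rho>}. 0)\<bar>) * (\<delta> * \<delta> * (\<alpha> 0 * \<phi> d))"
    using Gamma_Lipschitz[OF xC yC, folded d_def] Gamma_growth[OF y] inv ab
    by (intro add_mono mult_mono') (auto intro: mult_nonneg_nonneg)
  finally have 1: "\<bar>\<Gamma> x / ?a - \<Gamma> y / ?b\<bar>
      \<le> \<delta> * L * d + \<delta>\<^sup>2 * \<alpha> 0 * (L * r + \<bar>\<Gamma> (\<lambda>t\<in>{0..\<rho>}. 0)\<bar>) * \<phi> d"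
    by (simp add: power2_eq_square algebra_simps)
  have sub: "{0..t} \<subseteq> {0..\<rho>}" using t by auto
  have g_int: "superposition \<rho> g x integrable_on {0..t}" "superposition \<rho> g y integrable_on {0..t}"
    by (intro integrable_continuous_real continuous_on_subset[OF continuous_on_super(2) sub] xC yC)+
  have gamma_int: "integrable (lebesgue_on {0..\<rho>}) \<gamma>"
    using gamma by (intro bounded_measurable_integrable_Icc)
  then have gamma_on: "\<gamma> integrable_on {0..\<rho>}"
    by (intro integrable_on_lebesgue_on) auto
  then have gamma_on': "\<gamma> integrable_on {0..t}"
    using sub by (rule integrable_subinterval_real)
  have LINT: "(LINT s|lebesgue_on {0..\<rho>}. \<bar>\<gamma> s\<bar>) = integral {0..\<rho>} \<gamma>"
  proof -
    have "(LINT s|lebesgue_on {0..\<rho>}. \<bar>\<gamma> s\<bar>) = (LINT s|lebesgue_on {0..\<rho>}. \<gamma> s)"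
      using gamma(2) by (intro Bochner_Integration.integral_cong) auto
    also have "\<dots> = integral {0..\<rho>} \<gamma>"
      using gamma_int by (intro lebesgue_integral_eq_integral) auto
    finally show ?thesis .
  qed
  have "\<bar>integral {0..t} (\<lambda>s. superposition \<rho> g x s - superposition \<rho> g y s)\<bar>
      \<le> integral {0..t} (\<lambda>s. \<gamma> s * \<psi> d)"
    unfolding real_norm_def[symmetric]
  proof (rule integral_norm_bound_integral)
    fix s assume "s \<in> {0..t}"
    with sub have s: "s \<in> {0..\<rho>}" by auto
    have "\<bar>g s (x s) - g s (y s)\<bar> \<le> \<gamma> s * \<psi> \<bar>x s - y s\<bar>"
      by (rule g_modulus[OF s abs_le_r[OF x s] abs_le_r[OF y s]])
    also have "\<dots> \<le> \<gamma> s * \<psi> d"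
      using dist[OF s] d gamma(2)[OF s] by (intro mult_left_mono mono_onD[OF psi(1)]) auto
    finally show "norm (superposition \<rho> g x s - superposition \<rho> g y s) \<le> \<gamma> s * \<psi> d"
      using s by (simp add: superposition_def)
  qed (use g_int gamma_on' in \<open>auto intro: integrable_diff integrable_on_mult_left\<close>)
  also have "\<dots> = integral {0..t} \<gamma> * \<psi> d" by simp
  also have "\<dots> \<le> integral {0..\<rho>} \<gamma> * \<psi> d"
    using psi(3)[OF d] gamma(2) sub gamma_on gamma_on'
    by (intro mult_right_mono integral_subset_le) auto
  finally have 2: "\<bar>integral {0..t} (superposition \<rho> g x) - integral {0..t} (superposition \<rho> g y)\<bar>
      \<le> (LINT s|lebesgue_on {0..\<rho>}. \<bar>\<gamma> s\<bar>) * \<psi> d"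
    using g_int by (simp add: integral_diff LINT)
  show ?thesis
    using 1 2 unfolding inner_op_def by linarith
qed

text \<open>
  Splitting the difference of the products \<open>f * inner_op\<close> bounds it by \<open>M\<^sub>F\<close> times the increment of
  the second factor plus \<open>M\<^sub>G\<close> times the increment of the first; these two add up to \<open>\<Phi>\<close>.
\<close>

lemma exact_op_contraction:
  assumes x: "x \<in> closed_ball_C \<rho> r" and y: "y \<in> closed_ball_C \<rho> r"
  shows "sup_norm \<rho> (\<lambda>t. exact_op \<rho> f g \<Gamma> x t - exact_op \<rho> f g \<Gamma> y t)
    \<le> \<Phi> (sup_norm \<rho> (\<lambda>t. x t - y t))"
proof (rule sup_norm_le)
  fix t assume t: "t \<in> {0..\<rho>}"
  define d where "d = sup_norm \<rho> (\<lambda>t. x t - y t)"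
  have "continuous_on {0..\<rho>} (\<lambda>t. x t - y t)"
    using x y by (auto simp: closed_ball_C_def C_space_iff intro: continuous_on_diff)
  from continuous_abs_le_sup_norm[OF this t] have dist: "\<bar>x t - y t\<bar> \<le> d"
    by (simp add: d_def)
  have "\<bar>f t (x t) - f t (y t)\<bar> \<le> \<alpha> t * \<phi> \<bar>x t - y t\<bar>"
    by (rule f_modulus[OF t abs_le_r[OF x t] abs_le_r[OF y t]])
  also have "\<dots> \<le> sup_norm \<rho> \<alpha> * \<phi> d"
  proof (rule mult_mono')
    show "\<alpha> t \<le> sup_norm \<rho> \<alpha>" using abs_le_sup_norm[OF alpha(1) t] by simp
    show "\<phi> \<bar>x t - y t\<bar> \<le> \<phi> d" using dist by (intro mono_onD[OF phi(1)]) auto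
  qed (use alpha(2)[OF t] phi(3) in auto)
  finally have f_diff: "\<bar>f t (x t) - f t (y t)\<bar> \<le> sup_norm \<rho> \<alpha> * \<phi> d" .
  have "exact_op \<rho> f g \<Gamma> x t - exact_op \<rho> f g \<Gamma> y t
      = f t (x t) * (inner_op x t - inner_op y t) + inner_op y t * (f t (x t) - f t (y t))"
    by (simp add: exact_op_eq_inner_op[OF t] algebra_simps)
  then have "\<bar>exact_op \<rho> f g \<Gamma> x t - exact_op \<rho> f g \<Gamma> y t\<bar>
      \<le> \<bar>f t (x t)\<bar> * \<bar>inner_op x t - inner_op y t\<bar> + \<bar>inner_op y t\<bar> * \<bar>f t (x t) - f t (y t)\<bar>"
    by (metis abs_mult abs_triangle_ineq)
  also have "\<dots> \<le> M\<^sub>F * (\<delta> * L * d + \<delta>\<^sup>2 * \<alpha> 0 * (L * r + \<bar>\<Gamma> (\<lambda>t\<in>{0..\<rho>}. 0)\<bar>) * \<phi> d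
       + (LINT s|lebesgue_on {0..\<rho>}. \<bar>\<gamma> s\<bar>) * \<psi> d) + M\<^sub>G * (sup_norm \<rho> \<alpha> * \<phi> d)"
    using f_growth[OF t abs_le_r[OF x t]] inner_op_growth[OF y t] f_diff
      inner_op_modulus[OF x y t, folded d_def]
    by (intro add_mono mult_mono') auto
  also have "\<dots> = \<Phi> d"
    by (simp add: \<Phi>_def algebra_simps)
  finally show "\<bar>exact_op \<rho> f g \<Gamma> x t - exact_op \<rho> f g \<Gamma> y t\<bar> \<le> \<Phi> (sup_norm \<rho> (\<lambda>t. x t - y t))"
    by (simp add: d_def)
qed (use rho_pos in simp)

lemma exact_op_iterates_converge:
  assumes Phi_less: "\<And>t. t > 0 \<Longrightarrow> \<Phi> t < t"
    and x: "x \<in> closed_ball_C \<rho> r"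
    and z: "z \<in> closed_ball_C \<rho> r" "exact_op \<rho> f g \<Gamma> z = z"
  shows "(\<lambda>p. sup_norm \<rho> (\<lambda>t. (exact_op \<rho> f g \<Gamma> ^^ p) x t - z t)) \<longlonglongrightarrow> 0"
proof (rule Boyd_Wong_orbit_tendsto_0[OF _ _ continuous_on_Phi Phi_less])
  have ball: "(exact_op \<rho> f g \<Gamma> ^^ p) x \<in> closed_ball_C \<rho> r" for p
    using x by (induction p) (auto intro: exact_op_in_closed_ball)
  show "sup_norm \<rho> (\<lambda>t. (exact_op \<rho> f g \<Gamma> ^^ Suc p) x t - z t)
      \<le> \<Phi> (sup_norm \<rho> (\<lambda>t. (exact_op \<rho> f g \<Gamma> ^^ p) x t - z t))" for p
    using exact_op_contraction[OF ball z(1), of p] z(2) by simp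
  show "0 \<le> sup_norm \<rho> (\<lambda>t. (exact_op \<rho> f g \<Gamma> ^^ p) x t - z t)" for p
    using rho_pos ball[of p] z(1)
    by (intro sup_norm_nonneg bounded_continuous_image_Icc continuous_on_diff)
      (auto simp: closed_ball_C_def C_space_iff)
qed

end

section \<open>Approximation of the solution\<close>

theorem theorem4p2:
  fixes \<rho> r \<delta> L\<^sub>\<Gamma> M\<^sub>F M\<^sub>G :: real
    and f g :: "real \<Rightarrow> real \<Rightarrow> real"
    and \<Gamma> :: "(real \<Rightarrow> real) \<Rightarrow> real"
    and \<phi> \<psi> \<alpha> \<gamma> :: "real \<Rightarrow> real"
    and x\<^sub>s\<^sub>o\<^sub>l :: "real \<Rightarrow> real"
    and \<tau> :: "nat \<Rightarrow> real \<Rightarrow> real"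
  assumes "\<rho> > 0"
    and f_nonzero: "\<And>t x. t \<in> {0..\<rho>} \<Longrightarrow> f t x \<noteq> 0"
    and i_f: "\<And>x. continuous_on {0..\<rho>} (\<lambda>t. f t x)"
    and i_g: "\<And>x. continuous_on {0..\<rho>} (\<lambda>t. g t x)"
    and i_L: "L\<^sub>\<Gamma> \<ge> 0"
    and i_Lipschitz: "\<And>x y. x \<in> C_space \<rho> \<Longrightarrow> y \<in> C_space \<rho> \<Longrightarrow>
           \<bar>\<Gamma> x - \<Gamma> y\<bar> \<le> L\<^sub>\<Gamma> * sup_norm \<rho> (\<lambda>t. x t - y t)"
    and ii_r: "r > 0"
    and ii_phi: "mono_on {0..} \<phi>" "continuous_on {0..} \<phi>" "\<And>t. t \<ge> 0 \<Longrightarrow> \<phi> t \<ge> 0"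
    and ii_psi: "mono_on {0..} \<psi>" "continuous_on {0..} \<psi>" "\<And>t. t \<ge> 0 \<Longrightarrow> \<psi> t \<ge> 0"
    and ii_alpha: "bounded (\<alpha> ` {0..\<rho>})" "\<And>t. t \<in> {0..\<rho>} \<Longrightarrow> \<alpha> t \<ge> 0"
    and ii_gamma: "bounded (\<gamma> ` {0..\<rho>})" "\<And>t. t \<in> {0..\<rho>} \<Longrightarrow> \<gamma> t \<ge> 0"
           "\<gamma> \<in> borel_measurable (lebesgue_on {0..\<rho>})"
    and ii_f: "\<And>t x y. t \<in> {0..\<rho>} \<Longrightarrow> \<bar>x\<bar> \<le> r \<Longrightarrow> \<bar>y\<bar> \<le> r \<Longrightarrow>
           \<bar>f t x - f t y\<bar> \<le> \<alpha> t * \<phi> \<bar>x - y\<bar>"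
    and ii_g: "\<And>t x y. t \<in> {0..\<rho>} \<Longrightarrow> \<bar>x\<bar> \<le> r \<Longrightarrow> \<bar>y\<bar> \<le> r \<Longrightarrow>
           \<bar>g t x - g t y\<bar> \<le> \<gamma> t * \<psi> \<bar>x - y\<bar>"
    and iii: "\<delta> > 0" "bdd_above ((\<lambda>x. inverse \<bar>f 0 x\<bar>) ` {x. \<bar>x\<bar> \<le> r})"
           "(SUP x\<in>{x. \<bar>x\<bar> \<le> r}. inverse \<bar>f 0 x\<bar>) \<le> \<delta>"
    and iv_MF: "M\<^sub>F = sup_norm \<rho> \<alpha> * \<phi> r + sup_norm \<rho> (\<lambda>t. f t 0)"
    and iv_MG: "M\<^sub>G = \<delta> * (L\<^sub>\<Gamma> * r + \<bar>\<Gamma> (\<lambda>t\<in>{0..\<rho>}. 0)\<bar>)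
                   + \<rho> * sup_norm \<rho> \<gamma> * \<psi> r + \<rho> * sup_norm \<rho> (\<lambda>t. g t 0)"
    and iv_r: "M\<^sub>F * M\<^sub>G \<le> r"
    and iv: "\<And>t. t > 0 \<Longrightarrow>
           M\<^sub>F * \<delta> * L\<^sub>\<Gamma> * t
           + (M\<^sub>F * \<delta>\<^sup>2 * \<alpha> 0 * (L\<^sub>\<Gamma> * r + \<bar>\<Gamma> (\<lambda>t\<in>{0..\<rho>}. 0)\<bar>) + M\<^sub>G * sup_norm \<rho> \<alpha>) * \<phi> t
           + M\<^sub>F * (LINT s|lebesgue_on {0..\<rho>}. \<bar>\<gamma> s\<bar>) * \<psi> t < t"
    and v_F: "\<And>x. x \<in> C_space \<rho> \<Longrightarrow> superposition \<rho> f x \<in> C_space \<rho>"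
    and v_U: "\<And>x. x \<in> C_space \<rho> \<Longrightarrow> superposition \<rho> g x \<in> C_space \<rho>"
    and sol: "x\<^sub>s\<^sub>o\<^sub>l \<in> closed_ball_C \<rho> r" "is_solution \<rho> f g \<Gamma> x\<^sub>s\<^sub>o\<^sub>l"
    and basis: "schauder_basis \<rho> \<tau>"
  shows "\<forall>x\<in>closed_ball_C \<rho> r. \<forall>\<epsilon>>0. \<exists>m\<ge>1. \<exists>n :: nat \<Rightarrow> nat.
           (\<forall>p\<in>{1..m}. n p \<ge> 1) \<and>
           sup_norm \<rho> (\<lambda>t. x\<^sub>s\<^sub>o\<^sub>l t -
             fold (\<lambda>p. approx_op \<rho> f g \<Gamma> \<tau> (n p)) [1..<Suc m] x t) \<le> \<epsilon>"
proof -
  interpret hybrid_problem \<rho> L\<^sub>\<Gamma> f g \<Gamma> r \<delta> M\<^sub>F M\<^sub>G \<phi> \<psi> \<alpha> \<gamma>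
  proof unfold_locales
    fix u :: real assume "\<bar>u\<bar> \<le> r"
    then have "inverse \<bar>f 0 u\<bar> \<le> (SUP x\<in>{x. \<bar>x\<bar> \<le> r}. inverse \<bar>f 0 x\<bar>)"
      by (intro cSUP_upper iii(2)) simp
    also note iii(3)
    finally show "inverse \<bar>f 0 u\<bar> \<le> \<delta>" .
  qed (fact assms)+
  let ?T = "exact_op \<rho> f g \<Gamma>"
  have fixed: "?T x\<^sub>s\<^sub>o\<^sub>l = x\<^sub>s\<^sub>o\<^sub>l"
    using sol(2) by (rule is_solution_imp_exact_op_fixed)
  have Phi_less: "\<Phi> t < t" if "t > 0" for t
    using iv[OF that] by (simp add: \<Phi>_def)
  show ?thesis
  proof (intro ballI allI impI)
    fix x and \<epsilon> :: real assume x: "x \<in> closed_ball_C \<rho> r" and "\<epsilon> > 0"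
    have xC: "x \<in> C_space \<rho>" and solC: "continuous_on {0..\<rho>} x\<^sub>s\<^sub>o\<^sub>l"
      using x sol(1) by (auto simp: closed_ball_C_def C_space_iff)
    have "\<forall>\<^sub>F m in sequentially. sup_norm \<rho> (\<lambda>t. (?T ^^ m) x t - x\<^sub>s\<^sub>o\<^sub>l t) < \<epsilon> / 2"
      using exact_op_iterates_converge[OF Phi_less x sol(1) fixed] \<open>\<epsilon> > 0\<close>
      by (intro order_tendstoD(2)) auto
    with eventually_ge_at_top[of 1]
    have "\<forall>\<^sub>F m in sequentially. m \<ge> 1 \<and> sup_norm \<rho> (\<lambda>t. (?T ^^ m) x t - x\<^sub>s\<^sub>o\<^sub>l t) < \<epsilon> / 2"
      by (rule eventually_conj)
    then obtain m where "m \<ge> 1" and m: "sup_norm \<rho> (\<lambda>t. (?T ^^ m) x t - x\<^sub>s\<^sub>o\<^sub>l t) < \<epsilon> / 2"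
      by (auto simp: eventually_sequentially)
    obtain n where n: "\<And>k q. n k q \<ge> (1::nat)"
      and lim: "uniform_limit {0..\<rho>} (\<lambda>k. fold (\<lambda>q. approx_op \<rho> f g \<Gamma> \<tau> (n k q)) [1..<Suc m] x)
        ((?T ^^ m) x) sequentially"
      using approx_op_compositions_tend_to_exact_iterate[OF basis xC, of m] by blast
    obtain k where k: "\<And>t. t \<in> {0..\<rho>} \<Longrightarrow>
        dist (fold (\<lambda>q. approx_op \<rho> f g \<Gamma> \<tau> (n k q)) [1..<Suc m] x t) ((?T ^^ m) x t) < \<epsilon> / 2"
      using uniform_limitD[OF lim, of "\<epsilon> / 2"] \<open>\<epsilon> > 0\<close> unfolding eventually_sequentially by force
    have "continuous_on {0..\<rho>} (\<lambda>t. (?T ^^ m) x t - x\<^sub>s\<^sub>o\<^sub>l t)"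
      using exact_op_funpow_in_C_space[OF xC] solC by (intro continuous_on_diff) (simp_all add: C_space_iff)
    from continuous_abs_le_sup_norm[OF this]
    have near: "\<bar>(?T ^^ m) x t - x\<^sub>s\<^sub>o\<^sub>l t\<bar> < \<epsilon> / 2" if "t \<in> {0..\<rho>}" for t
      using that m by fastforce
    have "sup_norm \<rho> (\<lambda>t. x\<^sub>s\<^sub>o\<^sub>l t - fold (\<lambda>q. approx_op \<rho> f g \<Gamma> \<tau> (n k q)) [1..<Suc m] x t) \<le> \<epsilon>"
    proof (rule sup_norm_le)
      fix t assume "t \<in> {0..\<rho>}"
      from k[OF this] near[OF this]
      show "\<bar>x\<^sub>s\<^sub>o\<^sub>l t - fold (\<lambda>q. approx_op \<rho> f g \<Gamma> \<tau> (n k q)) [1..<Suc m] x t\<bar> \<le> \<epsilon>"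
        unfolding dist_real_def by linarith
    qed (use \<open>\<rho> > 0\<close> in simp)
    with \<open>m \<ge> 1\<close> n show "\<exists>m\<ge>1. \<exists>n :: nat \<Rightarrow> nat.
           (\<forall>p\<in>{1..m}. n p \<ge> 1) \<and>
           sup_norm \<rho> (\<lambda>t. x\<^sub>s\<^sub>o\<^sub>l t -
             fold (\<lambda>p. approx_op \<rho> f g \<Gamma> \<tau> (n p)) [1..<Suc m] x t) \<le> \<epsilon>"
      by (intro exI[of _ m] exI[of _ "n k"] conjI ballI)
  qed
qed

end
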